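(* Let $R$ be a domain and $M$ a nonzero absolutely pure left $R$-module. If $M$ has a maximal proper pp subgroup, then $M$ is pp-simple and torsionfree. Conversely, if $M$ is torsionfree, then $M$ is pp-simple (hence has a unique maximal proper pp subgroup).
   Context: A domain is an associative ring with $1$, not necessarily commutative, without zero divisors. A module is absolutely pure if it is pure in every module containing it. A pp subgroup of $M$ is a subgroup of the form $\phi(M)=\{a\in M:\exists\bar c\ \text{in } M,\ A\bar c=\mathbf ba\}$ with $A$ an $n\times m$ matrix and $\mathbf b$ a column of length $n$ over $R$. $M$ is pp-simple if it has no proper pp subgroups other than $0$. $M$ is torsionfree if $sa=0$ with $s\in R$, $s\ne0$, $a\in M$ implies $a=0$. *)

theory Defs
  imports "HOL-Algebra.Module"
begin

text \<open>
  The locales \<open>domain\<close> and \<open>module\<close> of HOL-Algebra presuppose a commutative ring, so their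
  noncommutative counterparts are introduced here; the record type of modules is reused
  (its multiplicative fields \<open>mult\<close> and \<open>one\<close> play no role).
\<close>

locale noncomm_domain = ring R for R (structure) +
  assumes one_not_zero [simp]: "\<one> \<noteq> \<zero>"
    and integral: "\<lbrakk>a \<in> carrier R; b \<in> carrier R; a \<otimes> b = \<zero>\<rbrakk> \<Longrightarrow> a = \<zero> \<or> b = \<zero>"

locale left_module = R?: ring R + M?: abelian_group M for R (structure) and M (structure) +
  assumes smult_closed [simp, intro]:
      "\<lbrakk>a \<in> carrier R; x \<in> carrier M\<rbrakk> \<Longrightarrow> a \<odot>\<^bsub>M\<^esub> x \<in> carrier M"
    and smult_l_distr:
      "\<lbrakk>a \<in> carrier R; b \<in> carrier R; x \<in> carrier M\<rbrakk> \<Longrightarrow>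
        (a \<oplus> b) \<odot>\<^bsub>M\<^esub> x = a \<odot>\<^bsub>M\<^esub> x \<oplus>\<^bsub>M\<^esub> b \<odot>\<^bsub>M\<^esub> x"
    and smult_r_distr:
      "\<lbrakk>a \<in> carrier R; x \<in> carrier M; y \<in> carrier M\<rbrakk> \<Longrightarrow>
        a \<odot>\<^bsub>M\<^esub> (x \<oplus>\<^bsub>M\<^esub> y) = a \<odot>\<^bsub>M\<^esub> x \<oplus>\<^bsub>M\<^esub> a \<odot>\<^bsub>M\<^esub> y"
    and smult_assoc1:
      "\<lbrakk>a \<in> carrier R; b \<in> carrier R; x \<in> carrier M\<rbrakk> \<Longrightarrow>
        (a \<otimes> b) \<odot>\<^bsub>M\<^esub> x = a \<odot>\<^bsub>M\<^esub> (b \<odot>\<^bsub>M\<^esub> x)"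
    and smult_one [simp]: "x \<in> carrier M \<Longrightarrow> \<one> \<odot>\<^bsub>M\<^esub> x = x"

text \<open>
  Matrices and columns are functions on \<open>nat\<close> of which only the entries with
  indices below the given sizes matter.
\<close>

definition solvable_system ::
  "('r, 'p) ring_scheme \<Rightarrow> ('r, 'm, 'q) module_scheme \<Rightarrow>
    nat \<Rightarrow> nat \<Rightarrow> (nat \<Rightarrow> nat \<Rightarrow> 'r) \<Rightarrow> (nat \<Rightarrow> 'm) \<Rightarrow> bool"
  where "solvable_system R M n m A d \<longleftrightarrow>
    (\<exists>c. (\<forall>j<m. c j \<in> carrier M) \<and>
         (\<forall>i<n. (\<Oplus>\<^bsub>M\<^esub>j\<in>{..<m}. A i j \<odot>\<^bsub>M\<^esub> c j) = d i))"

definition pp_subgroup ::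
  "('r, 'p) ring_scheme \<Rightarrow> ('r, 'm, 'q) module_scheme \<Rightarrow> 'm set \<Rightarrow> bool"
  where "pp_subgroup R M P \<longleftrightarrow>
    (\<exists>n m A b. (\<forall>i<n. \<forall>j<m. A i j \<in> carrier R) \<and> (\<forall>i<n. b i \<in> carrier R) \<and>
       P = {a \<in> carrier M. solvable_system R M n m A (\<lambda>i. b i \<odot>\<^bsub>M\<^esub> a)})"

definition module_embedding ::
  "('r, 'p) ring_scheme \<Rightarrow> ('r, 'm, 'q) module_scheme \<Rightarrow> ('r, 'n, 's) module_scheme \<Rightarrow>
    ('m \<Rightarrow> 'n) \<Rightarrow> bool"
  where "module_embedding R M N f \<longleftrightarrow>
    f \<in> carrier M \<rightarrow> carrier N \<and> inj_on f (carrier M) \<and>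
    (\<forall>x\<in>carrier M. \<forall>y\<in>carrier M. f (x \<oplus>\<^bsub>M\<^esub> y) = f x \<oplus>\<^bsub>N\<^esub> f y) \<and>
    (\<forall>r\<in>carrier R. \<forall>x\<in>carrier M. f (r \<odot>\<^bsub>M\<^esub> x) = r \<odot>\<^bsub>N\<^esub> f x)"

text \<open>
  Purity of the image of an embedding: every finite system of linear equations with constants
  in \<open>M\<close> that is solvable in \<open>N\<close> is already solvable in \<open>M\<close>. Lemma \<open>pure_embedding_iff_pp\<close>
  gives the version with pp formulas in several free variables.
\<close>

definition pure_embedding ::
  "('r, 'p) ring_scheme \<Rightarrow> ('r, 'm, 'q) module_scheme \<Rightarrow> ('r, 'n, 's) module_scheme \<Rightarrow>
    ('m \<Rightarrow> 'n) \<Rightarrow> bool"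
  where "pure_embedding R M N f \<longleftrightarrow>
    module_embedding R M N f \<and>
    (\<forall>n m A d. (\<forall>i<n. \<forall>j<m. A i j \<in> carrier R) \<longrightarrow> (\<forall>i<n. d i \<in> carrier M) \<longrightarrow>
       solvable_system R N n m A (\<lambda>i. f (d i)) \<longrightarrow> solvable_system R M n m A d)"

text \<open>
  A definition cannot quantify over all types, so the extensions \<open>N\<close> are taken with
  carrier in one fixed type, chosen large enough to hold all quotients of the modules
  \<open>M \<oplus> R\<^sup>k\<close>. This is no restriction: by lemma \<open>absolutely_pure_imp_pure_embedding\<close> below, an
  absolutely pure module is pure in every extension over every type.
\<close>

definition absolutely_pure ::
  "('r, 'p) ring_scheme \<Rightarrow> ('r, 'm, 'q) module_scheme \<Rightarrow> bool"
  where "absolutely_pure R M \<longleftrightarrow>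
    (\<forall>(N :: ('r, ('m \<times> (nat \<Rightarrow> 'r)) set) module) f.
       left_module R N \<longrightarrow> module_embedding R M N f \<longrightarrow> pure_embedding R M N f)"

definition pp_simple ::
  "('r, 'p) ring_scheme \<Rightarrow> ('r, 'm, 'q) module_scheme \<Rightarrow> bool"
  where "pp_simple R M \<longleftrightarrow>
    (\<forall>P. pp_subgroup R M P \<longrightarrow> P \<noteq> carrier M \<longrightarrow> P = {\<zero>\<^bsub>M\<^esub>})"

definition maximal_proper_pp_subgroup ::
  "('r, 'p) ring_scheme \<Rightarrow> ('r, 'm, 'q) module_scheme \<Rightarrow> 'm set \<Rightarrow> bool"
  where "maximal_proper_pp_subgroup R M P \<longleftrightarrow>
    pp_subgroup R M P \<and> P \<noteq> carrier M \<and>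
    (\<forall>Q. pp_subgroup R M Q \<longrightarrow> Q \<noteq> carrier M \<longrightarrow> P \<subseteq> Q \<longrightarrow> Q = P)"

definition torsionfree ::
  "('r, 'p) ring_scheme \<Rightarrow> ('r, 'm, 'q) module_scheme \<Rightarrow> bool"
  where "torsionfree R M \<longleftrightarrow>
    (\<forall>s\<in>carrier R. \<forall>a\<in>carrier M. s \<noteq> \<zero>\<^bsub>R\<^esub> \<longrightarrow> s \<odot>\<^bsub>M\<^esub> a = \<zero>\<^bsub>M\<^esub> \<longrightarrow> a = \<zero>\<^bsub>M\<^esub>)"


subsection \<open>Independence of the choices made above\<close>

context left_module
begin

lemma smult_zero_left: "x \<in> carrier M \<Longrightarrow> \<zero> \<odot>\<^bsub>M\<^esub> x = \<zero>\<^bsub>M\<^esub>"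
  by (metis M.add.l_cancel_one' R.add.one_closed R.add.l_one smult_closed smult_l_distr)

lemma smult_zero_right: "a \<in> carrier R \<Longrightarrow> a \<odot>\<^bsub>M\<^esub> \<zero>\<^bsub>M\<^esub> = \<zero>\<^bsub>M\<^esub>"
  by (metis M.add.l_cancel_one' M.add.one_closed M.add.l_one smult_closed smult_r_distr)

lemma smult_finsum:
  assumes "finite I" "a \<in> carrier R" "g \<in> I \<rightarrow> carrier M"
  shows "a \<odot>\<^bsub>M\<^esub> finsum M g I = finsum M (\<lambda>i. a \<odot>\<^bsub>M\<^esub> g i) I"
  using assms
proof (induction I)
  case empty
  then show ?case by (simp add: smult_zero_right)
next
  case (insert i I)
  then have "g \<in> I \<rightarrow> carrier M" "g i \<in> carrier M" by auto
  moreover have "(\<lambda>i. a \<odot>\<^bsub>M\<^esub> g i) \<in> I \<rightarrow> carrier M" using insert by auto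
  ultimately show ?case using insert by (simp add: smult_r_distr)
qed

end

lemma embedding_zero:
  assumes "left_module R M" "left_module R N" "module_embedding R M N f"
  shows "f \<zero>\<^bsub>M\<^esub> = \<zero>\<^bsub>N\<^esub>"
proof -
  interpret M: left_module R M by fact
  interpret N: left_module R N by fact
  have "f \<zero>\<^bsub>M\<^esub> \<in> carrier N" and "f (\<zero>\<^bsub>M\<^esub> \<oplus>\<^bsub>M\<^esub> \<zero>\<^bsub>M\<^esub>) = f \<zero>\<^bsub>M\<^esub> \<oplus>\<^bsub>N\<^esub> f \<zero>\<^bsub>M\<^esub>"
    using assms(3) M.M.zero_closed unfolding module_embedding_def by blast+
  then show ?thesis by simp
qed

lemma embedding_finsum:
  assumes "left_module R M" "left_module R N" "module_embedding R M N f"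
    and "finite I" "g \<in> I \<rightarrow> carrier M"
  shows "f (finsum M g I) = finsum N (\<lambda>i. f (g i)) I"
proof -
  interpret M: left_module R M by fact
  interpret N: left_module R N by fact
  have f: "\<And>x. x \<in> carrier M \<Longrightarrow> f x \<in> carrier N"
    "\<And>x y. x \<in> carrier M \<Longrightarrow> y \<in> carrier M \<Longrightarrow> f (x \<oplus>\<^bsub>M\<^esub> y) = f x \<oplus>\<^bsub>N\<^esub> f y"
    using assms(3) by (auto simp: module_embedding_def)
  show ?thesis
    using assms(4,5)
  proof (induction I)
    case empty
    then show ?case by (simp add: embedding_zero[OF assms(1-3)])
  next
    case (insert i I)
    then have "g \<in> I \<rightarrow> carrier M" "g i \<in> carrier M" by auto
    moreover have "(\<lambda>i. f (g i)) \<in> I \<rightarrow> carrier N" using insert f by auto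
    ultimately show ?case using insert f by simp
  qed
qed

lemma solvable_system_embed:
  assumes "left_module R M" "left_module R N" "module_embedding R M N f"
    and A: "\<forall>i<n. \<forall>j<m. A i j \<in> carrier R"
    and "solvable_system R M n m A d"
  shows "solvable_system R N n m A (\<lambda>i. f (d i))"
proof -
  interpret M: left_module R M by fact
  interpret N: left_module R N by fact
  have f: "\<And>x. x \<in> carrier M \<Longrightarrow> f x \<in> carrier N"
    "\<And>a x. a \<in> carrier R \<Longrightarrow> x \<in> carrier M \<Longrightarrow> f (a \<odot>\<^bsub>M\<^esub> x) = a \<odot>\<^bsub>N\<^esub> f x"
    using assms(3) by (auto simp: module_embedding_def)
  obtain c where c: "\<forall>j<m. c j \<in> carrier M"
    "\<forall>i<n. (\<Oplus>\<^bsub>M\<^esub>j\<in>{..<m}. A i j \<odot>\<^bsub>M\<^esub> c j) = d i"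
    using assms(5) by (auto simp: solvable_system_def)
  have "(\<Oplus>\<^bsub>N\<^esub>j\<in>{..<m}. A i j \<odot>\<^bsub>N\<^esub> f (c j)) = f (d i)" if "i < n" for i
  proof -
    have "f (d i) = (\<Oplus>\<^bsub>N\<^esub>j\<in>{..<m}. f (A i j \<odot>\<^bsub>M\<^esub> c j))"
      unfolding c(2)[rule_format, OF that, symmetric]
      by (rule embedding_finsum[OF assms(1-3)]) (use A c that in auto)
    also have "\<dots> = (\<Oplus>\<^bsub>N\<^esub>j\<in>{..<m}. A i j \<odot>\<^bsub>N\<^esub> f (c j))"
      by (rule N.finsum_cong') (use A c that f in auto)
    finally show ?thesis by simp
  qed
  then show ?thesis
    unfolding solvable_system_def using c f by (intro exI[of _ "\<lambda>j. f (c j)"]) auto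
qed

lemma pure_embedding_iff_pp:
  fixes R :: "('r, 'p) ring_scheme" and M :: "('r, 'm, 'q) module_scheme"
    and N :: "('r, 'n, 's) module_scheme"
  assumes M: "left_module R M" and N: "left_module R N" and emb: "module_embedding R M N f"
  shows "pure_embedding R M N f \<longleftrightarrow>
    (\<forall>n m (k :: nat) A B a. (\<forall>i<n. \<forall>j<m. A i j \<in> carrier R) \<longrightarrow> (\<forall>i<n. \<forall>l<k. B i l \<in> carrier R) \<longrightarrow>
       (\<forall>l<k. a l \<in> carrier M) \<longrightarrow>
       (solvable_system R M n m A (\<lambda>i. \<Oplus>\<^bsub>M\<^esub>l\<in>{..<k}. B i l \<odot>\<^bsub>M\<^esub> a l) \<longleftrightarrow>
        solvable_system R N n m A (\<lambda>i. \<Oplus>\<^bsub>N\<^esub>l\<in>{..<k}. B i l \<odot>\<^bsub>N\<^esub> f (a l))))"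
    (is "?L \<longleftrightarrow> ?R")
proof -
  interpret M: left_module R M by fact
  interpret N: left_module R N by fact
  have f: "\<And>x. x \<in> carrier M \<Longrightarrow> f x \<in> carrier N"
    "\<And>a x. a \<in> carrier R \<Longrightarrow> x \<in> carrier M \<Longrightarrow> f (a \<odot>\<^bsub>M\<^esub> x) = a \<odot>\<^bsub>N\<^esub> f x"
    using emb by (auto simp: module_embedding_def)
  have cong: "solvable_system R K n m A d \<longleftrightarrow> solvable_system R K n m A d'"
    if "\<And>i. i < n \<Longrightarrow> d i = d' i" for K :: "('r, 'k, 'l) module_scheme" and n m A d d'
    using that by (auto simp: solvable_system_def)
  have push: "f (\<Oplus>\<^bsub>M\<^esub>l\<in>{..<k}. b l \<odot>\<^bsub>M\<^esub> a l) = (\<Oplus>\<^bsub>N\<^esub>l\<in>{..<k}. b l \<odot>\<^bsub>N\<^esub> f (a l))"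
    if "\<forall>l<k. b l \<in> carrier R" "\<forall>l<k. a l \<in> carrier M" for b a and k :: nat
  proof -
    have "f (\<Oplus>\<^bsub>M\<^esub>l\<in>{..<k}. b l \<odot>\<^bsub>M\<^esub> a l) = (\<Oplus>\<^bsub>N\<^esub>l\<in>{..<k}. f (b l \<odot>\<^bsub>M\<^esub> a l))"
      by (rule embedding_finsum[OF assms]) (use that in auto)
    also have "\<dots> = (\<Oplus>\<^bsub>N\<^esub>l\<in>{..<k}. b l \<odot>\<^bsub>N\<^esub> f (a l))"
      by (rule N.finsum_cong') (use that f in auto)
    finally show ?thesis .
  qed
  have unit: "(\<Oplus>\<^bsub>M\<^esub>l\<in>{..<n}. (if l = i then \<one>\<^bsub>R\<^esub> else \<zero>\<^bsub>R\<^esub>) \<odot>\<^bsub>M\<^esub> d l) = d i"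
    if "i < n" "\<forall>l<n. d l \<in> carrier M" for i d and n :: nat
  proof -
    have "(\<Oplus>\<^bsub>M\<^esub>l\<in>{..<n}. (if l = i then \<one>\<^bsub>R\<^esub> else \<zero>\<^bsub>R\<^esub>) \<odot>\<^bsub>M\<^esub> d l) =
        (\<Oplus>\<^bsub>M\<^esub>l\<in>{..<n}. if i = l then d l else \<zero>\<^bsub>M\<^esub>)"
      by (rule M.finsum_cong') (use that in \<open>auto simp: M.smult_zero_left\<close>)
    then show ?thesis using that by (simp add: M.finsum_singleton)
  qed
  show ?thesis
  proof
    assume L: ?L
    show ?R
    proof (intro allI impI)
      fix n m k :: nat and A B a
      assume A: "\<forall>i<n. \<forall>j<m. A i j \<in> carrier R" and B: "\<forall>i<n. \<forall>l<k. B i l \<in> carrier R"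
        and a: "\<forall>l<k. a l \<in> carrier M"
      define d where "d = (\<lambda>i. \<Oplus>\<^bsub>M\<^esub>l\<in>{..<k}. B i l \<odot>\<^bsub>M\<^esub> a l)"
      have d: "\<forall>i<n. d i \<in> carrier M"
        unfolding d_def using B a by (auto intro!: M.finsum_closed)
      have "solvable_system R N n m A (\<lambda>i. \<Oplus>\<^bsub>N\<^esub>l\<in>{..<k}. B i l \<odot>\<^bsub>N\<^esub> f (a l)) \<longleftrightarrow>
          solvable_system R N n m A (\<lambda>i. f (d i))"
        unfolding d_def using B a by (intro cong) (simp add: push)
      also have "\<dots> \<longleftrightarrow> solvable_system R M n m A d"
        using L A d solvable_system_embed[OF assms, of n m A d]
        unfolding pure_embedding_def by blast
      finally show "solvable_system R M n m A (\<lambda>i. \<Oplus>\<^bsub>M\<^esub>l\<in>{..<k}. B i l \<odot>\<^bsub>M\<^esub> a l) \<longleftrightarrow>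
        solvable_system R N n m A (\<lambda>i. \<Oplus>\<^bsub>N\<^esub>l\<in>{..<k}. B i l \<odot>\<^bsub>N\<^esub> f (a l))"
        unfolding d_def by (rule sym)
    qed
  next
    assume Rr: ?R
    show ?L
      unfolding pure_embedding_def
    proof (intro conjI allI impI emb)
      fix n m :: nat and A d
      assume A: "\<forall>i<n. \<forall>j<m. A i j \<in> carrier R" and d: "\<forall>i<n. d i \<in> carrier M"
        and s: "solvable_system R N n m A (\<lambda>i. f (d i))"
      define B where "B = (\<lambda>i l :: nat. if l = i then \<one>\<^bsub>R\<^esub> else \<zero>\<^bsub>R\<^esub>)"
      have B: "\<forall>i<n. \<forall>l<n. B i l \<in> carrier R" by (auto simp: B_def)
      have dB: "d i = (\<Oplus>\<^bsub>M\<^esub>l\<in>{..<n}. B i l \<odot>\<^bsub>M\<^esub> d l)" if "i < n" for i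
        unfolding B_def using unit[OF that d] by simp
      have "f (d i) = (\<Oplus>\<^bsub>N\<^esub>l\<in>{..<n}. B i l \<odot>\<^bsub>N\<^esub> f (d l))" if "i < n" for i
        using push[of n "B i" d] B d that dB[OF that] by simp
      then have "solvable_system R N n m A (\<lambda>i. \<Oplus>\<^bsub>N\<^esub>l\<in>{..<n}. B i l \<odot>\<^bsub>N\<^esub> f (d l))"
        by (rule cong[THEN iffD1, OF _ s])
      then have "solvable_system R M n m A (\<lambda>i. \<Oplus>\<^bsub>M\<^esub>l\<in>{..<n}. B i l \<odot>\<^bsub>M\<^esub> d l)"
        using Rr A B d by blast
      then show "solvable_system R M n m A d"
        by (subst cong[OF dB])
    qed
  qed
qed

lemma left_module_transport:
  fixes N :: "('r, 'n, 's) module_scheme" and h :: "'n \<Rightarrow> 'k"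
  assumes "left_module R N" and S: "S \<subseteq> carrier N" and inj: "inj_on h S"
    and zero: "\<zero>\<^bsub>N\<^esub> \<in> S"
    and add: "\<And>x y. x \<in> S \<Longrightarrow> y \<in> S \<Longrightarrow> x \<oplus>\<^bsub>N\<^esub> y \<in> S"
    and smult: "\<And>a x. a \<in> carrier R \<Longrightarrow> x \<in> S \<Longrightarrow> a \<odot>\<^bsub>N\<^esub> x \<in> S"
  shows "\<exists>K :: ('r, 'k) module. left_module R K \<and> carrier K = h ` S \<and>
    (\<forall>x\<in>S. \<forall>y\<in>S. h x \<oplus>\<^bsub>K\<^esub> h y = h (x \<oplus>\<^bsub>N\<^esub> y)) \<and>
    (\<forall>a\<in>carrier R. \<forall>x\<in>S. a \<odot>\<^bsub>K\<^esub> h x = h (a \<odot>\<^bsub>N\<^esub> x))"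
proof -
  interpret N: left_module R N by fact
  define u where "u = inv_into S h"
  define K :: "('r, 'k) module" where
    "K = \<lparr>carrier = h ` S, mult = undefined, one = undefined, zero = h \<zero>\<^bsub>N\<^esub>,
          add = (\<lambda>x y. h (u x \<oplus>\<^bsub>N\<^esub> u y)), smult = (\<lambda>a x. h (a \<odot>\<^bsub>N\<^esub> u x))\<rparr>"
  have u [simp]: "u (h x) = x" if "x \<in> S" for x
    using that inj by (simp add: u_def)
  have SN: "x \<in> S \<Longrightarrow> x \<in> carrier N" for x using S by blast
  have K: "carrier K = h ` S" "zero K = h \<zero>\<^bsub>N\<^esub>"
    "\<And>x y. x \<in> S \<Longrightarrow> y \<in> S \<Longrightarrow> h x \<oplus>\<^bsub>K\<^esub> h y = h (x \<oplus>\<^bsub>N\<^esub> y)"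
    "\<And>a x. x \<in> S \<Longrightarrow> a \<odot>\<^bsub>K\<^esub> h x = h (a \<odot>\<^bsub>N\<^esub> x)"
    by (simp_all add: K_def)
  have neg: "\<exists>y\<in>S. y \<oplus>\<^bsub>N\<^esub> x = \<zero>\<^bsub>N\<^esub>" if "x \<in> S" for x
  proof -
    have "(\<ominus>\<^bsub>R\<^esub> \<one>\<^bsub>R\<^esub>) \<odot>\<^bsub>N\<^esub> x \<in> S" using that by (intro smult) auto
    moreover have "(\<ominus>\<^bsub>R\<^esub> \<one>\<^bsub>R\<^esub>) \<odot>\<^bsub>N\<^esub> x \<oplus>\<^bsub>N\<^esub> x = \<zero>\<^bsub>N\<^esub>"
      using N.smult_l_distr[of "\<ominus>\<^bsub>R\<^esub> \<one>\<^bsub>R\<^esub>" "\<one>\<^bsub>R\<^esub>" x] SN[OF that]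
      by (simp add: N.R.l_neg N.smult_zero_left)
    ultimately show ?thesis by blast
  qed
  have "abelian_group K"
  proof (rule abelian_groupI)
    fix x assume "x \<in> carrier K"
    then obtain x' where x': "x' \<in> S" "x = h x'" by (auto simp: K)
    obtain y' where "y' \<in> S" "y' \<oplus>\<^bsub>N\<^esub> x' = \<zero>\<^bsub>N\<^esub>" using neg x' by blast
    then show "\<exists>y\<in>carrier K. y \<oplus>\<^bsub>K\<^esub> x = \<zero>\<^bsub>K\<^esub>"
      using x' by (intro bexI[of _ "h y'"]) (auto simp: K)
  qed (auto simp: K zero add SN N.M.a_ac)
  then have "left_module R K"
    by (intro left_module.intro left_module_axioms.intro N.R.ring_axioms)
      (auto simp: K SN add smult N.smult_l_distr N.smult_r_distr N.smult_assoc1)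
  then show ?thesis using K by (intro exI[of _ K]) auto
qed

theorem absolutely_pure_imp_pure_embedding:
  fixes R :: "('r, 'p) ring_scheme" and M :: "('r, 'm, 'q) module_scheme"
    and N :: "('r, 'n, 's) module_scheme"
  assumes M: "left_module R M" and pure: "absolutely_pure R M"
    and N: "left_module R N" and emb: "module_embedding R M N f"
  shows "pure_embedding R M N f"
  unfolding pure_embedding_def
proof (intro conjI allI impI emb)
  interpret M: left_module R M by fact
  interpret N: left_module R N by fact
  have f: "\<And>x. x \<in> carrier M \<Longrightarrow> f x \<in> carrier N" "inj_on f (carrier M)"
    "\<And>x y. x \<in> carrier M \<Longrightarrow> y \<in> carrier M \<Longrightarrow> f (x \<oplus>\<^bsub>M\<^esub> y) = f x \<oplus>\<^bsub>N\<^esub> f y"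
    "\<And>a x. a \<in> carrier R \<Longrightarrow> x \<in> carrier M \<Longrightarrow> f (a \<odot>\<^bsub>M\<^esub> x) = a \<odot>\<^bsub>N\<^esub> f x"
    using emb by (auto simp: module_embedding_def)
  fix n m A d
  assume A: "\<forall>i<n. \<forall>j<m. A i j \<in> carrier R" and d: "\<forall>i<n. d i \<in> carrier M"
    and "solvable_system R N n m A (\<lambda>i. f (d i))"
  then obtain c where c: "\<And>j. j < m \<Longrightarrow> c j \<in> carrier N"
    and sol: "\<And>i. i < n \<Longrightarrow> (\<Oplus>\<^bsub>N\<^esub>j\<in>{..<m}. A i j \<odot>\<^bsub>N\<^esub> c j) = f (d i)"
    unfolding solvable_system_def by blast
  define D where "D = carrier M \<times> ({..<m} \<rightarrow> carrier R)"
  define sm where "sm = (\<lambda>r. \<Oplus>\<^bsub>N\<^esub>j\<in>{..<m}. r j \<odot>\<^bsub>N\<^esub> c j)"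
  define g where "g = (\<lambda>(x, r). f x \<oplus>\<^bsub>N\<^esub> sm r)"
  define S where "S = g ` D"
  define h where "h = (\<lambda>y. {p \<in> D. g p = y})"
  have sm_closed [simp]: "sm r \<in> carrier N" if "r \<in> {..<m} \<rightarrow> carrier R" for r
    unfolding sm_def using that c by (intro N.finsum_closed) auto
  have sm_add: "sm r \<oplus>\<^bsub>N\<^esub> sm r' = sm (\<lambda>j. r j \<oplus>\<^bsub>R\<^esub> r' j)"
    if "r \<in> {..<m} \<rightarrow> carrier R" "r' \<in> {..<m} \<rightarrow> carrier R" for r r'
  proof -
    have "sm (\<lambda>j. r j \<oplus>\<^bsub>R\<^esub> r' j) =
        (\<Oplus>\<^bsub>N\<^esub>j\<in>{..<m}. r j \<odot>\<^bsub>N\<^esub> c j \<oplus>\<^bsub>N\<^esub> r' j \<odot>\<^bsub>N\<^esub> c j)"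
      unfolding sm_def
      by (rule N.finsum_cong') (use that c in \<open>auto simp: N.smult_l_distr Pi_iff\<close>)
    also have "\<dots> = sm r \<oplus>\<^bsub>N\<^esub> sm r'"
      unfolding sm_def by (rule N.finsum_addf) (use that c in auto)
    finally show ?thesis by simp
  qed
  have sm_smult: "a \<odot>\<^bsub>N\<^esub> sm r = sm (\<lambda>j. a \<otimes>\<^bsub>R\<^esub> r j)"
    if "a \<in> carrier R" "r \<in> {..<m} \<rightarrow> carrier R" for a r
  proof -
    have "a \<odot>\<^bsub>N\<^esub> sm r = (\<Oplus>\<^bsub>N\<^esub>j\<in>{..<m}. a \<odot>\<^bsub>N\<^esub> (r j \<odot>\<^bsub>N\<^esub> c j))"
      unfolding sm_def by (rule N.smult_finsum) (use that c in auto)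
    also have "\<dots> = sm (\<lambda>j. a \<otimes>\<^bsub>R\<^esub> r j)"
      unfolding sm_def
      by (rule N.finsum_cong') (use that c in \<open>auto simp: N.smult_assoc1 Pi_iff\<close>)
    finally show ?thesis .
  qed
  have sm_zero: "sm (\<lambda>j. \<zero>\<^bsub>R\<^esub>) = \<zero>\<^bsub>N\<^esub>"
  proof -
    have "sm (\<lambda>j. \<zero>\<^bsub>R\<^esub>) = (\<Oplus>\<^bsub>N\<^esub>j\<in>{..<m}. \<zero>\<^bsub>N\<^esub>)"
      unfolding sm_def by (rule N.finsum_cong') (use c in \<open>auto simp: N.smult_zero_left\<close>)
    then show ?thesis by simp
  qed
  have f0: "f \<zero>\<^bsub>M\<^esub> = \<zero>\<^bsub>N\<^esub>" by (rule embedding_zero[OF M N emb])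
  have SI: "f x \<oplus>\<^bsub>N\<^esub> sm r \<in> S" if "x \<in> carrier M" "r \<in> {..<m} \<rightarrow> carrier R" for x r
    unfolding S_def D_def g_def using that by force
  have SE: "\<exists>x r. x \<in> carrier M \<and> r \<in> {..<m} \<rightarrow> carrier R \<and> y = f x \<oplus>\<^bsub>N\<^esub> sm r"
    if "y \<in> S" for y
    using that unfolding S_def D_def g_def by auto
  have fS: "f x \<in> S" if "x \<in> carrier M" for x
    using SI[OF that, of "\<lambda>j. \<zero>\<^bsub>R\<^esub>"] f(1)[OF that] by (simp add: sm_zero)
  have cS: "c j \<in> S" if "j < m" for j
  proof -
    have "sm (\<lambda>l. if l = j then \<one>\<^bsub>R\<^esub> else \<zero>\<^bsub>R\<^esub>) =
        (\<Oplus>\<^bsub>N\<^esub>l\<in>{..<m}. if j = l then c l else \<zero>\<^bsub>N\<^esub>)"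
      unfolding sm_def
      by (rule N.finsum_cong') (use that c in \<open>auto simp: N.smult_zero_left\<close>)
    also have "\<dots> = c j" using that c by (simp add: N.finsum_singleton)
    finally show ?thesis
      using SI[of "\<zero>\<^bsub>M\<^esub>" "\<lambda>l. if l = j then \<one>\<^bsub>R\<^esub> else \<zero>\<^bsub>R\<^esub>"] c[OF that] by (simp add: f0)
  qed
  have SN: "S \<subseteq> carrier N" using SE f(1) by fastforce
  have Sadd: "x \<oplus>\<^bsub>N\<^esub> y \<in> S" if xy: "x \<in> S" "y \<in> S" for x y
  proof -
    obtain x' r where x: "x' \<in> carrier M" "r \<in> {..<m} \<rightarrow> carrier R" "x = f x' \<oplus>\<^bsub>N\<^esub> sm r"
      using SE xy by blast
    obtain y' s where y: "y' \<in> carrier M" "s \<in> {..<m} \<rightarrow> carrier R" "y = f y' \<oplus>\<^bsub>N\<^esub> sm s"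
      using SE xy by blast
    have "x \<oplus>\<^bsub>N\<^esub> y = (f x' \<oplus>\<^bsub>N\<^esub> f y') \<oplus>\<^bsub>N\<^esub> (sm r \<oplus>\<^bsub>N\<^esub> sm s)"
      using x y f(1) by (simp add: N.M.a_ac)
    also have "\<dots> = f (x' \<oplus>\<^bsub>M\<^esub> y') \<oplus>\<^bsub>N\<^esub> sm (\<lambda>j. r j \<oplus>\<^bsub>R\<^esub> s j)"
      using x y f(3) by (simp add: sm_add)
    also have "\<dots> \<in> S" using x y by (intro SI) (auto simp: Pi_iff)
    finally show ?thesis .
  qed
  have Ssmult: "a \<odot>\<^bsub>N\<^esub> x \<in> S" if ax: "a \<in> carrier R" "x \<in> S" for a x
  proof -
    obtain x' r where x: "x' \<in> carrier M" "r \<in> {..<m} \<rightarrow> carrier R" "x = f x' \<oplus>\<^bsub>N\<^esub> sm r"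
      using SE ax by blast
    have "a \<odot>\<^bsub>N\<^esub> x = f (a \<odot>\<^bsub>M\<^esub> x') \<oplus>\<^bsub>N\<^esub> sm (\<lambda>j. a \<otimes>\<^bsub>R\<^esub> r j)"
      using x f(1,4) ax by (simp add: N.smult_r_distr sm_smult)
    also have "\<dots> \<in> S" using x ax by (intro SI) (auto simp: Pi_iff)
    finally show ?thesis .
  qed
  have inj: "inj_on h S"
    unfolding inj_on_def h_def S_def by blast
  have "\<zero>\<^bsub>N\<^esub> \<in> S" using fS[of "\<zero>\<^bsub>M\<^esub>"] f0 by simp
  then have "\<exists>K :: ('r, ('m \<times> (nat \<Rightarrow> 'r)) set) module. left_module R K \<and> carrier K = h ` S \<and>
      (\<forall>x\<in>S. \<forall>y\<in>S. h x \<oplus>\<^bsub>K\<^esub> h y = h (x \<oplus>\<^bsub>N\<^esub> y)) \<and>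
      (\<forall>a\<in>carrier R. \<forall>x\<in>S. a \<odot>\<^bsub>K\<^esub> h x = h (a \<odot>\<^bsub>N\<^esub> x))"
    by (rule left_module_transport[OF N SN inj _ Sadd Ssmult])
  then obtain K :: "('r, ('m \<times> (nat \<Rightarrow> 'r)) set) module" where K: "left_module R K"
    and carr: "carrier K = h ` S"
    and Kadd': "\<forall>x\<in>S. \<forall>y\<in>S. h x \<oplus>\<^bsub>K\<^esub> h y = h (x \<oplus>\<^bsub>N\<^esub> y)"
    and Ksmult': "\<forall>a\<in>carrier R. \<forall>x\<in>S. a \<odot>\<^bsub>K\<^esub> h x = h (a \<odot>\<^bsub>N\<^esub> x)"
    by (elim exE conjE) (rule that)
  note Kadd = Kadd'[rule_format] and Ksmult = Ksmult'[rule_format]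
  interpret K: left_module R K by fact
  have K0: "h \<zero>\<^bsub>N\<^esub> = \<zero>\<^bsub>K\<^esub>"
    using Kadd[OF \<open>\<zero>\<^bsub>N\<^esub> \<in> S\<close> \<open>\<zero>\<^bsub>N\<^esub> \<in> S\<close>] \<open>\<zero>\<^bsub>N\<^esub> \<in> S\<close> carr by simp
  have hsum: "h (finsum N t I) = finsum K (\<lambda>j. h (t j)) I \<and> finsum N t I \<in> S"
    if "finite I" "t \<in> I \<rightarrow> S" for t and I :: "nat set"
    using that
  proof (induction I)
    case empty
    then show ?case by (simp add: K0 \<open>\<zero>\<^bsub>N\<^esub> \<in> S\<close>)
  next
    case (insert i I)
    then have t: "t \<in> I \<rightarrow> S" "t i \<in> S" by auto
    then have "t \<in> I \<rightarrow> carrier N" "t i \<in> carrier N"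
      "(\<lambda>j. h (t j)) \<in> I \<rightarrow> carrier K" "h (t i) \<in> carrier K"
      using SN carr by auto
    then show ?case using insert t Sadd Kadd[of "t i" "finsum N t I"] by simp
  qed
  have embK: "module_embedding R M K (\<lambda>x. h (f x))"
    unfolding module_embedding_def
    using fS f carr inj Kadd Ksmult by (auto simp: inj_on_def)
  have "(\<Oplus>\<^bsub>K\<^esub>j\<in>{..<m}. A i j \<odot>\<^bsub>K\<^esub> h (c j)) = h (f (d i))" if i: "i < n" for i
  proof -
    have "h (f (d i)) = (\<Oplus>\<^bsub>K\<^esub>j\<in>{..<m}. h (A i j \<odot>\<^bsub>N\<^esub> c j))"
      unfolding sol[OF i, symmetric]
      by (rule hsum[THEN conjunct1]) (use i A cS Ssmult in auto)
    also have "\<dots> = (\<Oplus>\<^bsub>K\<^esub>j\<in>{..<m}. A i j \<odot>\<^bsub>K\<^esub> h (c j))"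
      by (rule K.finsum_cong') (use i A cS in \<open>auto simp: carr Ksmult intro!: imageI Ssmult\<close>)
    finally show ?thesis by simp
  qed
  then have "solvable_system R K n m A (\<lambda>i. h (f (d i)))"
    unfolding solvable_system_def using cS carr by (intro exI[of _ "\<lambda>j. h (c j)"]) auto
  moreover have "pure_embedding R M K (\<lambda>x. h (f x))"
    using pure K embK unfolding absolutely_pure_def by blast
  ultimately show "solvable_system R M n m A d"
    using A d unfolding pure_embedding_def by blast
qed

end

theory Submission
  imports Defs
begin

text \<open>
  Over an absolutely pure module \<open>M\<close> a finite system \<open>A c = d\<close> is solvable as soon as it is
  consistent (\<open>r A = 0\<close> implies \<open>r d = 0\<close>), because it is solvable in the pushout
  \<open>(M \<oplus> R\<^sup>k) / {(r d, r A)}\<close>, into which \<open>M\<close> embeds by consistency. Hence every pp subgroup of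
  \<open>M\<close> is the annihilator in \<open>M\<close> of a set of scalars, and over a domain \<open>M\<close> is divisible.
  If \<open>M\<close> is torsionfree, such annihilators are \<open>M\<close> or \<open>0\<close>. If \<open>P\<close> is a maximal proper pp
  subgroup, it is contained in \<open>ann t\<close> for some \<open>t \<noteq> 0\<close>; by divisibility \<open>ann t\<close> and \<open>ann (s t)\<close>,
  for \<open>s \<noteq> 0\<close>, are proper, so both equal \<open>P\<close>. If \<open>s a = 0\<close>, write \<open>a = t b\<close>; then
  \<open>b \<in> ann (s t) = ann t\<close>, that is \<open>a = 0\<close>.
\<close>

section \<open>Finite sums and signs\<close>

text \<open>Additivity already forces \<open>h\<close> to fix zero by cancellation, so induction on
  \<open>I\<close> suffices. Scalar multiplication is left out of the hypotheses so that the lemma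
  covers coordinate projections, quotient maps and the map \<open>s \<mapsto> s a\<close> from the
  additive group of \<open>R\<close> to \<open>M\<close>.\<close>

lemma finsum_additive:
  assumes "abelian_group G" "abelian_group H"
    and closed: "\<And>x. x \<in> carrier G \<Longrightarrow> h x \<in> carrier H"
    and add: "\<And>x y. x \<in> carrier G \<Longrightarrow> y \<in> carrier G \<Longrightarrow> h (x \<oplus>\<^bsub>G\<^esub> y) = h x \<oplus>\<^bsub>H\<^esub> h y"
    and "finite I" "g \<in> I \<rightarrow> carrier G"
  shows "h (finsum G g I) = finsum H (\<lambda>i. h (g i)) I"
proof -
  interpret G: abelian_group G by fact
  interpret H: abelian_group H by fact
  have zero: "h \<zero>\<^bsub>G\<^esub> = \<zero>\<^bsub>H\<^esub>"
    using add[of "\<zero>\<^bsub>G\<^esub>" "\<zero>\<^bsub>G\<^esub>"] closed[of "\<zero>\<^bsub>G\<^esub>"] by simp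
  show ?thesis
    using assms(5,6)
  proof (induction I)
    case empty
    then show ?case by (simp add: zero)
  next
    case (insert i I)
    then have "g \<in> I \<rightarrow> carrier G" "g i \<in> carrier G" by auto
    moreover have "(\<lambda>i. h (g i)) \<in> I \<rightarrow> carrier H" using insert closed by auto
    ultimately show ?case using insert closed add by simp
  qed
qed

text \<open>Used to regroup \<open>r (A c)\<close> as \<open>(r A) c\<close>, where the sum over
  equations and the sum over unknowns change places.\<close>

lemma (in abelian_monoid) finsum_swap:
  assumes "finite I" "finite J" "\<And>i j. i \<in> I \<Longrightarrow> j \<in> J \<Longrightarrow> f i j \<in> carrier G"
  shows "(\<Oplus>i\<in>I. \<Oplus>j\<in>J. f i j) = (\<Oplus>j\<in>J. \<Oplus>i\<in>I. f i j)"
  using assms(1,3)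
proof (induction I)
  case empty
  then show ?case by simp
next
  case (insert i I)
  have f: "f i \<in> J \<rightarrow> carrier G" "\<And>j. j \<in> J \<Longrightarrow> (\<lambda>i. f i j) \<in> I \<rightarrow> carrier G"
    and g: "(\<lambda>i. \<Oplus>j\<in>J. f i j) \<in> I \<rightarrow> carrier G" "(\<lambda>j. \<Oplus>i\<in>I. f i j) \<in> J \<rightarrow> carrier G"
    using insert.prems by (auto intro!: finsum_closed)
  have "(\<Oplus>j\<in>J. \<Oplus>i\<in>insert i I. f i j) = (\<Oplus>j\<in>J. f i j \<oplus> (\<Oplus>i\<in>I. f i j))"
    by (rule finsum_cong') (use insert f g in \<open>auto simp: Pi_iff\<close>)
  also have "\<dots> = (\<Oplus>j\<in>J. f i j) \<oplus> (\<Oplus>j\<in>J. \<Oplus>i\<in>I. f i j)"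
    by (rule finsum_addf[OF f(1) g(2)])
  finally show ?case using insert f g by simp
qed

lemma (in left_module) smult_minus_one:
  assumes "x \<in> carrier M"
  shows "(\<ominus> \<one>) \<odot>\<^bsub>M\<^esub> x = \<ominus>\<^bsub>M\<^esub> x"
proof -
  have "(\<ominus> \<one>) \<odot>\<^bsub>M\<^esub> x \<oplus>\<^bsub>M\<^esub> x = \<zero>\<^bsub>M\<^esub>"
    using smult_l_distr[of "\<ominus> \<one>" \<one> x] assms by (simp add: R.l_neg smult_zero_left)
  then show ?thesis using assms by (metis M.minus_equality R.a_inv_closed R.one_closed smult_closed)
qed

lemma (in left_module) smult_minus_right:
  assumes "a \<in> carrier R" "x \<in> carrier M"
  shows "a \<odot>\<^bsub>M\<^esub> (\<ominus>\<^bsub>M\<^esub> x) = \<ominus>\<^bsub>M\<^esub> (a \<odot>\<^bsub>M\<^esub> x)"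
proof -
  have "a \<odot>\<^bsub>M\<^esub> (\<ominus>\<^bsub>M\<^esub> x) \<oplus>\<^bsub>M\<^esub> a \<odot>\<^bsub>M\<^esub> x = \<zero>\<^bsub>M\<^esub>"
    using smult_r_distr[of a "\<ominus>\<^bsub>M\<^esub> x" x] assms by (simp add: M.l_neg smult_zero_right)
  then show ?thesis using assms by (metis M.minus_equality M.a_inv_closed smult_closed)
qed

section \<open>Quotient modules and products with scalar sequences\<close>

text \<open>Cosets are represented as subsets of \<open>carrier K\<close>, so the quotient lives in
  the type \<open>'k set\<close>; for pairs of a module element and a scalar sequence this is the
  type over which \<open>absolutely_pure\<close> quantifies. Closure of \<open>L\<close> under
  negation comes from the scalar \<open>-1\<close>.\<close>

lemma quotient_left_module:
  fixes R :: "('r, 'p) ring_scheme" and K :: "('r, 'k, 'q) module_scheme"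
  assumes "left_module R K" and L: "L \<subseteq> carrier K" and zero: "\<zero>\<^bsub>K\<^esub> \<in> L"
    and add: "\<And>x y. x \<in> L \<Longrightarrow> y \<in> L \<Longrightarrow> x \<oplus>\<^bsub>K\<^esub> y \<in> L"
    and smult: "\<And>a x. a \<in> carrier R \<Longrightarrow> x \<in> L \<Longrightarrow> a \<odot>\<^bsub>K\<^esub> x \<in> L"
  shows "\<exists>(Q :: ('r, 'k set) module) p. left_module R Q \<and> carrier Q = p ` carrier K \<and>
    (\<forall>x\<in>carrier K. \<forall>y\<in>carrier K. p (x \<oplus>\<^bsub>K\<^esub> y) = p x \<oplus>\<^bsub>Q\<^esub> p y) \<and>
    (\<forall>a\<in>carrier R. \<forall>x\<in>carrier K. p (a \<odot>\<^bsub>K\<^esub> x) = a \<odot>\<^bsub>Q\<^esub> p x) \<and>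
    (\<forall>x\<in>carrier K. \<forall>y\<in>carrier K. p x = p y \<longleftrightarrow> x \<ominus>\<^bsub>K\<^esub> y \<in> L)"
proof -
  interpret K: left_module R K by fact
  have neg: "\<ominus>\<^bsub>K\<^esub> x \<in> L" if "x \<in> L" for x
    using smult[of "\<ominus>\<^bsub>R\<^esub> \<one>\<^bsub>R\<^esub>" x] that L K.smult_minus_one[of x] by auto
  have LK: "x \<in> L \<Longrightarrow> x \<in> carrier K" for x using L by blast
  \<comment> \<open>\<open>p x\<close> is the coset \<open>x + L\<close>, and \<open>u\<close> picks
    a representative of a coset. The operations of \<open>Q\<close> are computed on these
    representatives, so \<open>p_add\<close> and \<open>p_smult\<close> have to show that the choice
    does not matter.\<close>
  define p where "p = (\<lambda>x. {y \<in> carrier K. y \<ominus>\<^bsub>K\<^esub> x \<in> L})"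
  define u where "u = (\<lambda>X. SOME x. x \<in> carrier K \<and> p x = X)"
  define Q :: "('r, 'k set) module" where
    "Q = \<lparr>carrier = p ` carrier K, mult = undefined, one = undefined, zero = p \<zero>\<^bsub>K\<^esub>,
          add = (\<lambda>X Y. p (u X \<oplus>\<^bsub>K\<^esub> u Y)), smult = (\<lambda>a X. p (a \<odot>\<^bsub>K\<^esub> u X))\<rparr>"
  have p_eq: "p x = p y \<longleftrightarrow> x \<ominus>\<^bsub>K\<^esub> y \<in> L" if "x \<in> carrier K" "y \<in> carrier K" for x y
  proof
    assume "p x = p y"
    moreover have "x \<in> p x" using that zero by (simp add: p_def K.M.r_neg K.M.minus_eq)
    ultimately show "x \<ominus>\<^bsub>K\<^esub> y \<in> L" by (auto simp: p_def)
  next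
    assume xy: "x \<ominus>\<^bsub>K\<^esub> y \<in> L"
    have "\<ominus>\<^bsub>K\<^esub> (x \<ominus>\<^bsub>K\<^esub> y) = y \<ominus>\<^bsub>K\<^esub> x"
      using that by (simp add: K.M.minus_eq K.M.minus_add K.M.a_ac)
    then have yx: "y \<ominus>\<^bsub>K\<^esub> x \<in> L" using neg[OF xy] by simp
    \<comment> \<open>For \<open>z\<close> in \<open>K\<close>, the elements \<open>z - x\<close>
      and \<open>z - y\<close> differ by \<open>x - y\<close> or its negative, both in
      \<open>L\<close>, so they lie in \<open>L\<close> together.\<close>
    have split: "z \<ominus>\<^bsub>K\<^esub> b = (z \<ominus>\<^bsub>K\<^esub> a) \<oplus>\<^bsub>K\<^esub> (a \<ominus>\<^bsub>K\<^esub> b)"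
      if "z \<in> carrier K" "a \<in> carrier K" "b \<in> carrier K" for z a b
      using that by (simp add: K.M.minus_eq K.M.a_ac K.M.r_neg1 K.M.r_neg2)
    have "z \<ominus>\<^bsub>K\<^esub> x \<in> L \<longleftrightarrow> z \<ominus>\<^bsub>K\<^esub> y \<in> L" if "z \<in> carrier K" for z
      using split[of z x y] split[of z y x] add xy yx that \<open>x \<in> carrier K\<close> \<open>y \<in> carrier K\<close>
      by metis
    then show "p x = p y" unfolding p_def by blast
  qed
  have u: "u (p x) \<in> carrier K \<and> p (u (p x)) = p x" if "x \<in> carrier K" for x
    unfolding u_def by (rule someI[of _ x]) (use that in simp)
  have p_add: "p x \<oplus>\<^bsub>Q\<^esub> p y = p (x \<oplus>\<^bsub>K\<^esub> y)" if xy: "x \<in> carrier K" "y \<in> carrier K" for x y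
  proof -
    let ?x = "u (p x)" and ?y = "u (p y)"
    have c: "?x \<in> carrier K" "?y \<in> carrier K" using u xy by auto
    \<comment> \<open>Each chosen representative differs from the given one by an element of
      \<open>L\<close>, and the sum of these two differences is the difference of the sums.\<close>
    have "(?x \<ominus>\<^bsub>K\<^esub> x) \<oplus>\<^bsub>K\<^esub> (?y \<ominus>\<^bsub>K\<^esub> y) \<in> L"
      using u xy c by (intro add) (simp_all flip: p_eq)
    also have "(?x \<ominus>\<^bsub>K\<^esub> x) \<oplus>\<^bsub>K\<^esub> (?y \<ominus>\<^bsub>K\<^esub> y) = (?x \<oplus>\<^bsub>K\<^esub> ?y) \<ominus>\<^bsub>K\<^esub> (x \<oplus>\<^bsub>K\<^esub> y)"
      using c xy by (simp add: K.M.minus_eq K.M.minus_add K.M.a_ac)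
    finally show ?thesis using c xy by (simp add: Q_def p_eq)
  qed
  have p_smult: "a \<odot>\<^bsub>Q\<^esub> p x = p (a \<odot>\<^bsub>K\<^esub> x)" if ax: "a \<in> carrier R" "x \<in> carrier K" for a x
  proof -
    let ?x = "u (p x)"
    have c: "?x \<in> carrier K" using u ax by auto
    have "a \<odot>\<^bsub>K\<^esub> (?x \<ominus>\<^bsub>K\<^esub> x) \<in> L"
      using u ax c by (intro smult) (simp_all flip: p_eq)
    also have "a \<odot>\<^bsub>K\<^esub> (?x \<ominus>\<^bsub>K\<^esub> x) = a \<odot>\<^bsub>K\<^esub> ?x \<ominus>\<^bsub>K\<^esub> a \<odot>\<^bsub>K\<^esub> x"
      using c ax by (simp add: K.M.minus_eq K.smult_r_distr K.smult_minus_right)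
    finally show ?thesis using c ax by (simp add: Q_def p_eq)
  qed
  have Q: "carrier Q = p ` carrier K" "\<zero>\<^bsub>Q\<^esub> = p \<zero>\<^bsub>K\<^esub>" by (simp_all add: Q_def)
  have "abelian_group Q"
  proof (rule abelian_groupI)
    fix X assume "X \<in> carrier Q"
    then obtain x where x: "x \<in> carrier K" "X = p x" by (auto simp: Q)
    then show "\<exists>Y\<in>carrier Q. Y \<oplus>\<^bsub>Q\<^esub> X = \<zero>\<^bsub>Q\<^esub>"
      by (intro bexI[of _ "p (\<ominus>\<^bsub>K\<^esub> x)"]) (auto simp: Q p_add K.M.l_neg)
  qed (auto simp: Q p_add K.M.a_ac)
  then have "left_module R Q"
    by (intro left_module.intro left_module_axioms.intro K.R.ring_axioms)
      (auto simp: Q p_add p_smult K.smult_l_distr K.smult_r_distr K.smult_assoc1)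
  then show ?thesis
    using Q p_add p_smult p_eq by (intro exI[of _ Q] exI[of _ p]) simp
qed

text \<open>
  The coordinates of the free part range over all of \<open>nat\<close>, without support condition, so that
  no extensionality conditions arise.
\<close>

definition module_times_sequences ::
  "('r, 'p) ring_scheme \<Rightarrow> ('r, 'm, 'q) module_scheme \<Rightarrow> ('r, 'm \<times> (nat \<Rightarrow> 'r)) module"
  where "module_times_sequences R M =
    \<lparr>carrier = carrier M \<times> (UNIV \<rightarrow> carrier R), mult = undefined, one = undefined,
     zero = (\<zero>\<^bsub>M\<^esub>, \<lambda>j. \<zero>\<^bsub>R\<^esub>),
     add = (\<lambda>x y. (fst x \<oplus>\<^bsub>M\<^esub> fst y, \<lambda>j. snd x j \<oplus>\<^bsub>R\<^esub> snd y j)),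
     smult = (\<lambda>a x. (a \<odot>\<^bsub>M\<^esub> fst x, \<lambda>j. a \<otimes>\<^bsub>R\<^esub> snd x j))\<rparr>"

lemma module_times_sequences_simps:
  "carrier (module_times_sequences R M) = carrier M \<times> (UNIV \<rightarrow> carrier R)"
  "\<zero>\<^bsub>module_times_sequences R M\<^esub> = (\<zero>\<^bsub>M\<^esub>, \<lambda>j. \<zero>\<^bsub>R\<^esub>)"
  "x \<oplus>\<^bsub>module_times_sequences R M\<^esub> y = (fst x \<oplus>\<^bsub>M\<^esub> fst y, \<lambda>j. snd x j \<oplus>\<^bsub>R\<^esub> snd y j)"
  "a \<odot>\<^bsub>module_times_sequences R M\<^esub> x = (a \<odot>\<^bsub>M\<^esub> fst x, \<lambda>j. a \<otimes>\<^bsub>R\<^esub> snd x j)"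
  by (simp_all add: module_times_sequences_def)

lemma left_module_module_times_sequences:
  assumes "left_module R M"
  shows "left_module R (module_times_sequences R M)"
proof -
  interpret M: left_module R M by fact
  have "abelian_group (module_times_sequences R M)"
  proof (rule abelian_groupI)
    fix x assume "x \<in> carrier (module_times_sequences R M)"
    then show "\<exists>y\<in>carrier (module_times_sequences R M).
        y \<oplus>\<^bsub>module_times_sequences R M\<^esub> x = \<zero>\<^bsub>module_times_sequences R M\<^esub>"
      by (intro bexI[of _ "(\<ominus>\<^bsub>M\<^esub> fst x, \<lambda>j. \<ominus>\<^bsub>R\<^esub> snd x j)"])
        (auto simp: module_times_sequences_simps M.M.l_neg M.R.l_neg Pi_iff)
  qed (auto simp: module_times_sequences_simps M.M.a_ac M.R.a_ac Pi_iff)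
  then show ?thesis
    by (intro left_module.intro left_module_axioms.intro M.R.ring_axioms)
      (auto simp: module_times_sequences_simps M.smult_l_distr M.smult_r_distr M.smult_assoc1
        M.R.l_distr M.R.r_distr M.R.m_assoc Pi_iff)
qed

lemma finsum_module_times_sequences:
  assumes "left_module R M" "finite I" "g \<in> I \<rightarrow> carrier (module_times_sequences R M)"
  shows "finsum (module_times_sequences R M) g I =
    (finsum M (\<lambda>i. fst (g i)) I, \<lambda>j. finsum R (\<lambda>i. snd (g i) j) I)"
proof -
  interpret M: left_module R M by fact
  interpret K: left_module R "module_times_sequences R M"
    by (rule left_module_module_times_sequences) fact
  have "fst (finsum (module_times_sequences R M) g I) = finsum M (\<lambda>i. fst (g i)) I"
    by (rule finsum_additive[OF K.M.abelian_group_axioms M.M.abelian_group_axioms])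
      (use assms in \<open>auto simp: module_times_sequences_simps\<close>)
  moreover have "snd (finsum (module_times_sequences R M) g I) j = finsum R (\<lambda>i. snd (g i) j) I"
    for j
    by (rule finsum_additive[OF K.M.abelian_group_axioms M.R.abelian_group_axioms,
          where h = "\<lambda>x. snd x j"])
      (use assms in \<open>auto simp: module_times_sequences_simps\<close>)
  ultimately show ?thesis by (simp add: prod_eq_iff fun_eq_iff)
qed

section \<open>Consistent systems over absolutely pure modules\<close>

text \<open>Purity is applied to a single extension \<open>Q = K / L\<close>, where \<open>L\<close>
  is generated by the equations themselves, each constant \<open>d i\<close> paired with row
  \<open>i\<close> of \<open>A\<close>. The unit vectors of the sequence part become a solution in
  \<open>Q\<close>, and purity brings a solution back to \<open>M\<close>.\<close>

lemma absolutely_pure_solvable_system: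
  fixes R :: "('r, 'p) ring_scheme" and M :: "('r, 'm, 'q) module_scheme"
  assumes M: "left_module R M" and pure: "absolutely_pure R M"
    and A: "\<forall>i<n. \<forall>j<m. A i j \<in> carrier R" and d: "\<forall>i<n. d i \<in> carrier M"
    and consistent: "\<And>r. r \<in> {..<n} \<rightarrow> carrier R \<Longrightarrow>
      (\<And>j. j < m \<Longrightarrow> (\<Oplus>\<^bsub>R\<^esub>i\<in>{..<n}. r i \<otimes>\<^bsub>R\<^esub> A i j) = \<zero>\<^bsub>R\<^esub>) \<Longrightarrow>
      (\<Oplus>\<^bsub>M\<^esub>i\<in>{..<n}. r i \<odot>\<^bsub>M\<^esub> d i) = \<zero>\<^bsub>M\<^esub>"
  shows "solvable_system R M n m A d"
proof -
  interpret M: left_module R M by fact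
  define K where "K = module_times_sequences R M"
  note K_simps = module_times_sequences_simps[of R M, folded K_def]
  interpret K: left_module R K
    unfolding K_def by (rule left_module_module_times_sequences) fact
  \<comment> \<open>The constant and the row of the \<open>i\<close>-th equation; the row is padded
    with zeros from index \<open>m\<close> on, since the sequences in \<open>K\<close> have an entry
    at every natural number.\<close>
  define w where "w = (\<lambda>i. (d i, \<lambda>j. if j < m then A i j else \<zero>\<^bsub>R\<^esub>))"
  have w: "w i \<in> carrier K" if "i < n" for i
    using that A d by (auto simp: w_def K_simps)
  define lc where "lc = (\<lambda>r. \<Oplus>\<^bsub>K\<^esub>i\<in>{..<n}. r i \<odot>\<^bsub>K\<^esub> w i)"
  define L where "L = lc ` ({..<n} \<rightarrow> carrier R)"
  have lc_closed: "lc r \<in> carrier K" if "r \<in> {..<n} \<rightarrow> carrier R" for r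
    unfolding lc_def using that w by (intro K.finsum_closed) auto
  have lc_add: "lc r \<oplus>\<^bsub>K\<^esub> lc s = lc (\<lambda>i. r i \<oplus>\<^bsub>R\<^esub> s i)"
    if "r \<in> {..<n} \<rightarrow> carrier R" "s \<in> {..<n} \<rightarrow> carrier R" for r s
  proof -
    have "lc (\<lambda>i. r i \<oplus>\<^bsub>R\<^esub> s i) = (\<Oplus>\<^bsub>K\<^esub>i\<in>{..<n}. r i \<odot>\<^bsub>K\<^esub> w i \<oplus>\<^bsub>K\<^esub> s i \<odot>\<^bsub>K\<^esub> w i)"
      unfolding lc_def by (rule K.finsum_cong') (use that w in \<open>auto simp: K.smult_l_distr Pi_iff\<close>)
    also have "\<dots> = lc r \<oplus>\<^bsub>K\<^esub> lc s"
      unfolding lc_def by (rule K.finsum_addf) (use that w in auto)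
    finally show ?thesis by simp
  qed
  have lc_smult: "a \<odot>\<^bsub>K\<^esub> lc r = lc (\<lambda>i. a \<otimes>\<^bsub>R\<^esub> r i)"
    if "a \<in> carrier R" "r \<in> {..<n} \<rightarrow> carrier R" for a r
  proof -
    have "a \<odot>\<^bsub>K\<^esub> lc r = (\<Oplus>\<^bsub>K\<^esub>i\<in>{..<n}. a \<odot>\<^bsub>K\<^esub> (r i \<odot>\<^bsub>K\<^esub> w i))"
      unfolding lc_def by (rule K.smult_finsum) (use that w in auto)
    also have "\<dots> = lc (\<lambda>i. a \<otimes>\<^bsub>R\<^esub> r i)"
      unfolding lc_def by (rule K.finsum_cong') (use that w in \<open>auto simp: K.smult_assoc1 Pi_iff\<close>)
    finally show ?thesis .
  qed
  have lc_zero: "lc (\<lambda>i. \<zero>\<^bsub>R\<^esub>) = \<zero>\<^bsub>K\<^esub>"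
  proof -
    have "lc (\<lambda>i. \<zero>\<^bsub>R\<^esub>) = (\<Oplus>\<^bsub>K\<^esub>i\<in>{..<n}. \<zero>\<^bsub>K\<^esub>)"
      unfolding lc_def by (rule K.finsum_cong') (use w in \<open>auto simp: K.smult_zero_left\<close>)
    then show ?thesis by simp
  qed
  have lc_unit: "lc (\<lambda>l. if l = i then \<one>\<^bsub>R\<^esub> else \<zero>\<^bsub>R\<^esub>) = w i" if "i < n" for i
  proof -
    have "lc (\<lambda>l. if l = i then \<one>\<^bsub>R\<^esub> else \<zero>\<^bsub>R\<^esub>) = (\<Oplus>\<^bsub>K\<^esub>l\<in>{..<n}. if i = l then w l else \<zero>\<^bsub>K\<^esub>)"
      unfolding lc_def
      by (rule K.finsum_cong') (use that w in \<open>auto simp: K.smult_zero_left\<close>)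
    also have "\<dots> = w i" using that w by (simp add: K.finsum_singleton)
    finally show ?thesis .
  qed
  have wL: "w i \<in> L" if "i < n" for i
    unfolding L_def lc_unit[OF that, symmetric] by (rule imageI) auto
  have lc_coord: "lc r = (\<Oplus>\<^bsub>M\<^esub>i\<in>{..<n}. r i \<odot>\<^bsub>M\<^esub> d i,
      \<lambda>j. \<Oplus>\<^bsub>R\<^esub>i\<in>{..<n}. r i \<otimes>\<^bsub>R\<^esub> (if j < m then A i j else \<zero>\<^bsub>R\<^esub>))"
    if "r \<in> {..<n} \<rightarrow> carrier R" for r
  proof -
    have "(\<lambda>i. r i \<odot>\<^bsub>K\<^esub> w i) \<in> {..<n} \<rightarrow> carrier K" using that w by auto
    from finsum_module_times_sequences[OF M _ this[unfolded K_def], folded K_def]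
    show ?thesis by (simp add: lc_def K_simps w_def)
  qed
  \<comment> \<open>Consistency enters here: an element of \<open>L\<close> with vanishing sequence
    part comes from some \<open>r\<close> with \<open>r A = 0\<close>, so its module part
    \<open>r d\<close> is zero. Thus \<open>L\<close> meets the copy of \<open>M\<close> in
    \<open>K\<close> only in zero, which makes \<open>f\<close> injective.\<close>
  have L_fst: "x = \<zero>\<^bsub>M\<^esub>" if "(x, \<lambda>j. \<zero>\<^bsub>R\<^esub>) \<in> L" for x
  proof -
    obtain r where r: "r \<in> {..<n} \<rightarrow> carrier R" "lc r = (x, \<lambda>j. \<zero>\<^bsub>R\<^esub>)"
      using \<open>(x, \<lambda>j. \<zero>\<^bsub>R\<^esub>) \<in> L\<close> unfolding L_def by (metis (no_types, lifting) imageE)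
    then have x: "x = (\<Oplus>\<^bsub>M\<^esub>i\<in>{..<n}. r i \<odot>\<^bsub>M\<^esub> d i)"
      and z: "\<And>j. (\<Oplus>\<^bsub>R\<^esub>i\<in>{..<n}. r i \<otimes>\<^bsub>R\<^esub> (if j < m then A i j else \<zero>\<^bsub>R\<^esub>)) = \<zero>\<^bsub>R\<^esub>"
      by (auto simp: lc_coord dest: fun_cong)
    have "(\<Oplus>\<^bsub>R\<^esub>i\<in>{..<n}. r i \<otimes>\<^bsub>R\<^esub> A i j) = \<zero>\<^bsub>R\<^esub>" if "j < m" for j
      using z[of j] that by simp
    then show ?thesis using consistent[OF r(1)] x by simp
  qed
  have "L \<subseteq> carrier K" "\<zero>\<^bsub>K\<^esub> \<in> L"
    unfolding L_def using lc_closed lc_zero by (auto intro: image_eqI[of _ _ "\<lambda>i. \<zero>\<^bsub>R\<^esub>"])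
  moreover have "x \<oplus>\<^bsub>K\<^esub> y \<in> L" if "x \<in> L" "y \<in> L" for x y
    using that unfolding L_def by (auto simp: lc_add Pi_iff intro!: imageI)
  moreover have "a \<odot>\<^bsub>K\<^esub> x \<in> L" if "a \<in> carrier R" "x \<in> L" for a x
    using that unfolding L_def by (auto simp: lc_smult Pi_iff intro!: imageI)
  ultimately have "\<exists>(Q :: ('r, ('m \<times> (nat \<Rightarrow> 'r)) set) module) p. left_module R Q \<and>
      carrier Q = p ` carrier K \<and>
      (\<forall>x\<in>carrier K. \<forall>y\<in>carrier K. p (x \<oplus>\<^bsub>K\<^esub> y) = p x \<oplus>\<^bsub>Q\<^esub> p y) \<and>
      (\<forall>a\<in>carrier R. \<forall>x\<in>carrier K. p (a \<odot>\<^bsub>K\<^esub> x) = a \<odot>\<^bsub>Q\<^esub> p x) \<and>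
      (\<forall>x\<in>carrier K. \<forall>y\<in>carrier K. p x = p y \<longleftrightarrow> x \<ominus>\<^bsub>K\<^esub> y \<in> L)"
    by (rule quotient_left_module[OF K.left_module_axioms])
  then obtain Q :: "('r, ('m \<times> (nat \<Rightarrow> 'r)) set) module" and p
    where Q: "left_module R Q" and carr: "carrier Q = p ` carrier K"
      and p_add': "\<forall>x\<in>carrier K. \<forall>y\<in>carrier K. p (x \<oplus>\<^bsub>K\<^esub> y) = p x \<oplus>\<^bsub>Q\<^esub> p y"
      and p_smult': "\<forall>a\<in>carrier R. \<forall>x\<in>carrier K. p (a \<odot>\<^bsub>K\<^esub> x) = a \<odot>\<^bsub>Q\<^esub> p x"
      and p_eq': "\<forall>x\<in>carrier K. \<forall>y\<in>carrier K. p x = p y \<longleftrightarrow> x \<ominus>\<^bsub>K\<^esub> y \<in> L"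
    by (elim exE conjE) (rule that)
  note p_add = p_add'[rule_format] and p_smult = p_smult'[rule_format]
    and p_eq = p_eq'[rule_format]
  interpret Q: left_module R Q by fact
  \<comment> \<open>These are the differences that \<open>p_eq\<close> produces when a pair is
    compared with an element of the copy of \<open>M\<close>.\<close>
  have diff: "(x, v) \<ominus>\<^bsub>K\<^esub> (y, \<lambda>j. \<zero>\<^bsub>R\<^esub>) = (x \<ominus>\<^bsub>M\<^esub> y, v)"
    if "x \<in> carrier M" "y \<in> carrier M" "v \<in> UNIV \<rightarrow> carrier R" for x y v
  proof -
    have "\<ominus>\<^bsub>K\<^esub> (y, \<lambda>j. \<zero>\<^bsub>R\<^esub>) = (\<ominus>\<^bsub>M\<^esub> y, \<lambda>j. \<zero>\<^bsub>R\<^esub>)"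
      by (rule K.M.minus_equality) (use that in \<open>auto simp: K_simps M.M.l_neg\<close>)
    then show ?thesis using that by (auto simp: K.M.minus_eq K_simps M.M.minus_eq Pi_iff)
  qed
  \<comment> \<open>The sign makes \<open>w i \<in> L\<close> read as the \<open>i\<close>-th equation.\<close>
  define f where "f = (\<lambda>x. p (\<ominus>\<^bsub>M\<^esub> x, \<lambda>j. \<zero>\<^bsub>R\<^esub>))"
  have f: "f x \<in> carrier Q" if "x \<in> carrier M" for x
    using that by (auto simp: f_def carr K_simps)
  have f_inj: "x = y" if "x \<in> carrier M" "y \<in> carrier M" "f x = f y" for x y
  proof -
    have "(\<ominus>\<^bsub>M\<^esub> x \<ominus>\<^bsub>M\<^esub> (\<ominus>\<^bsub>M\<^esub> y), \<lambda>j. \<zero>\<^bsub>R\<^esub>) \<in> L"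
      using that p_eq[of "(\<ominus>\<^bsub>M\<^esub> x, \<lambda>j. \<zero>\<^bsub>R\<^esub>)" "(\<ominus>\<^bsub>M\<^esub> y, \<lambda>j. \<zero>\<^bsub>R\<^esub>)"]
      by (simp add: f_def diff K_simps)
    then have "\<ominus>\<^bsub>M\<^esub> x \<ominus>\<^bsub>M\<^esub> (\<ominus>\<^bsub>M\<^esub> y) = \<zero>\<^bsub>M\<^esub>" by (rule L_fst)
    then show ?thesis
      using that M.M.minus_equality[of "\<ominus>\<^bsub>M\<^esub> x" y]
      by (metis M.M.a_inv_closed M.M.minus_eq M.M.minus_minus)
  qed
  have "module_embedding R M Q f"
    unfolding module_embedding_def
  proof (intro conjI ballI inj_onI Pi_I)
    fix x y assume "x \<in> carrier M" "y \<in> carrier M"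
    then show "f (x \<oplus>\<^bsub>M\<^esub> y) = f x \<oplus>\<^bsub>Q\<^esub> f y"
      by (simp add: f_def M.M.minus_add K_simps flip: p_add)
  next
    fix a x assume "a \<in> carrier R" "x \<in> carrier M"
    then show "f (a \<odot>\<^bsub>M\<^esub> x) = a \<odot>\<^bsub>Q\<^esub> f x"
      by (simp add: f_def M.smult_minus_right K_simps flip: p_smult)
  qed (use f f_inj in auto)
  then have "pure_embedding R M Q f"
    using pure Q unfolding absolutely_pure_def by blast
  moreover have "solvable_system R Q n m A (\<lambda>i. f (d i))"
    unfolding solvable_system_def
  proof (intro exI conjI allI impI)
    \<comment> \<open>Standard unit vectors of the sequence part; their classes are the unknowns
      that solve the system in \<open>Q\<close>.\<close>
    define e :: "nat \<Rightarrow> 'm \<times> (nat \<Rightarrow> 'r)"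
      where "e = (\<lambda>j. (\<zero>\<^bsub>M\<^esub>, \<lambda>l. if l = j then \<one>\<^bsub>R\<^esub> else \<zero>\<^bsub>R\<^esub>))"
    have e: "e j \<in> carrier K" for j by (auto simp: e_def K_simps)
    show "p (e j) \<in> carrier Q" for j using e by (auto simp: carr)
    fix i assume i: "i < n"
    have g: "(\<lambda>j. A i j \<odot>\<^bsub>K\<^esub> e j) \<in> {..<m} \<rightarrow> carrier K" using A e i by auto
    have "(\<Oplus>\<^bsub>Q\<^esub>j\<in>{..<m}. A i j \<odot>\<^bsub>Q\<^esub> p (e j)) = (\<Oplus>\<^bsub>Q\<^esub>j\<in>{..<m}. p (A i j \<odot>\<^bsub>K\<^esub> e j))"
      by (rule Q.finsum_cong') (use A i e g in \<open>auto simp: p_smult carr\<close>)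
    also have "\<dots> = p (\<Oplus>\<^bsub>K\<^esub>j\<in>{..<m}. A i j \<odot>\<^bsub>K\<^esub> e j)"
      by (rule finsum_additive[symmetric,
            OF K.M.abelian_group_axioms Q.M.abelian_group_axioms])
        (use g p_add in \<open>auto simp: carr\<close>)
    \<comment> \<open>Combining the unit vectors with coefficients \<open>A i j\<close> rebuilds the
      padded row \<open>i\<close>, with module part zero.\<close>
    also have "(\<Oplus>\<^bsub>K\<^esub>j\<in>{..<m}. A i j \<odot>\<^bsub>K\<^esub> e j) = (\<zero>\<^bsub>M\<^esub>, snd (w i))"
    proof -
      have 1: "(\<Oplus>\<^bsub>M\<^esub>j\<in>{..<m}. A i j \<odot>\<^bsub>M\<^esub> \<zero>\<^bsub>M\<^esub>) = (\<Oplus>\<^bsub>M\<^esub>j\<in>{..<m}. \<zero>\<^bsub>M\<^esub>)"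
        by (rule M.finsum_cong') (use A i in \<open>auto simp: M.smult_zero_right\<close>)
      have "(\<Oplus>\<^bsub>R\<^esub>j\<in>{..<m}. A i j \<otimes>\<^bsub>R\<^esub> (if l = j then \<one>\<^bsub>R\<^esub> else \<zero>\<^bsub>R\<^esub>)) = snd (w i) l" for l
      proof -
        have "(\<Oplus>\<^bsub>R\<^esub>j\<in>{..<m}. A i j \<otimes>\<^bsub>R\<^esub> (if l = j then \<one>\<^bsub>R\<^esub> else \<zero>\<^bsub>R\<^esub>)) =
            (\<Oplus>\<^bsub>R\<^esub>j\<in>{..<m}. if l = j then A i j else \<zero>\<^bsub>R\<^esub>)"
          by (rule M.R.finsum_cong') (use A i in auto)
        also have "\<dots> = snd (w i) l"
        \<comment> \<open>From index \<open>m\<close> on no unit vector contributes, and the padding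
          in \<open>w\<close> is zero as well.\<close>
        proof (cases "l < m")
          case True
          then show ?thesis using A i by (simp add: w_def M.R.finsum_singleton)
        next
          case False
          then have "(\<Oplus>\<^bsub>R\<^esub>j\<in>{..<m}. if l = j then A i j else \<zero>\<^bsub>R\<^esub>) = (\<Oplus>\<^bsub>R\<^esub>j\<in>{..<m}. \<zero>\<^bsub>R\<^esub>)"
            by (intro M.R.finsum_cong') auto
          then show ?thesis using False by (simp add: w_def)
        qed
        finally show ?thesis .
      qed
      then show ?thesis
        using finsum_module_times_sequences[OF M _ g[unfolded K_def], folded K_def] 1
        by (simp add: K_simps e_def)
    qed
    \<comment> \<open>The difference of \<open>(0, snd (w i))\<close> and \<open>(- d i, 0)\<close>
      is \<open>w i\<close>, which lies in \<open>L\<close>.\<close>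
    also have "p (\<zero>\<^bsub>M\<^esub>, snd (w i)) = f (d i)"
    proof -
      have "snd (w i) \<in> UNIV \<rightarrow> carrier R" using w[OF i] by (auto simp: K_simps)
      moreover have "(d i, snd (w i)) \<in> L" using wL[OF i] by (simp add: w_def)
      ultimately show ?thesis
        unfolding f_def using d i by (subst p_eq) (auto simp: K_simps diff M.M.minus_eq)
    qed
    finally show "(\<Oplus>\<^bsub>Q\<^esub>j\<in>{..<m}. A i j \<odot>\<^bsub>Q\<^esub> p (e j)) = f (d i)" .
  qed
  ultimately show ?thesis using A d unfolding pure_embedding_def by blast
qed

section \<open>Annihilators and divisibility\<close>

text \<open>An element \<open>a\<close> outside \<open>P\<close> gives an unsolvable, hence
  inconsistent, system. The row vector \<open>r\<close> witnessing the inconsistency yields the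
  scalar \<open>t = r b\<close>, which kills \<open>P\<close> because \<open>r A = 0\<close> but
  does not kill \<open>a\<close>.\<close>

lemma proper_pp_subgroup_annihilated:
  assumes M: "left_module R M" and pure: "absolutely_pure R M"
    and P: "pp_subgroup R M P" "P \<noteq> carrier M"
  shows "\<exists>t\<in>carrier R. t \<noteq> \<zero>\<^bsub>R\<^esub> \<and> (\<forall>a\<in>P. t \<odot>\<^bsub>M\<^esub> a = \<zero>\<^bsub>M\<^esub>)"
proof -
  interpret M: left_module R M by fact
  obtain n m A b where A: "\<forall>i<n. \<forall>j<m. A i j \<in> carrier R" and b: "\<forall>i<n. b i \<in> carrier R"
    and P_eq: "P = {a \<in> carrier M. solvable_system R M n m A (\<lambda>i. b i \<odot>\<^bsub>M\<^esub> a)}"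
    using P(1) unfolding pp_subgroup_def by blast
  have comb: "(\<Oplus>\<^bsub>M\<^esub>i\<in>{..<n}. r i \<odot>\<^bsub>M\<^esub> (b i \<odot>\<^bsub>M\<^esub> a)) = (\<Oplus>\<^bsub>R\<^esub>i\<in>{..<n}. r i \<otimes>\<^bsub>R\<^esub> b i) \<odot>\<^bsub>M\<^esub> a"
    if "r \<in> {..<n} \<rightarrow> carrier R" "a \<in> carrier M" for r a
  proof -
    have "(\<Oplus>\<^bsub>R\<^esub>i\<in>{..<n}. r i \<otimes>\<^bsub>R\<^esub> b i) \<odot>\<^bsub>M\<^esub> a = (\<Oplus>\<^bsub>M\<^esub>i\<in>{..<n}. (r i \<otimes>\<^bsub>R\<^esub> b i) \<odot>\<^bsub>M\<^esub> a)"
      by (rule finsum_additive[OF M.R.abelian_group_axioms M.M.abelian_group_axioms,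
            where h = "\<lambda>s. s \<odot>\<^bsub>M\<^esub> a"])
        (use that b in \<open>auto simp: M.smult_l_distr\<close>)
    also have "\<dots> = (\<Oplus>\<^bsub>M\<^esub>i\<in>{..<n}. r i \<odot>\<^bsub>M\<^esub> (b i \<odot>\<^bsub>M\<^esub> a))"
      by (rule M.finsum_cong') (use that b in \<open>auto simp: M.smult_assoc1 Pi_iff\<close>)
    finally show ?thesis by simp
  qed
  obtain a where a: "a \<in> carrier M" "\<not> solvable_system R M n m A (\<lambda>i. b i \<odot>\<^bsub>M\<^esub> a)"
    using P(2) P_eq by blast
  have ba: "\<forall>i<n. b i \<odot>\<^bsub>M\<^esub> a \<in> carrier M" using a b by auto
  \<comment> \<open>The contrapositive of \<open>absolutely_pure_solvable_system\<close> for the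
    constants \<open>b i a\<close>.\<close>
  obtain r where r: "r \<in> {..<n} \<rightarrow> carrier R"
    and rA: "\<And>j. j < m \<Longrightarrow> (\<Oplus>\<^bsub>R\<^esub>i\<in>{..<n}. r i \<otimes>\<^bsub>R\<^esub> A i j) = \<zero>\<^bsub>R\<^esub>"
    and ra: "(\<Oplus>\<^bsub>M\<^esub>i\<in>{..<n}. r i \<odot>\<^bsub>M\<^esub> (b i \<odot>\<^bsub>M\<^esub> a)) \<noteq> \<zero>\<^bsub>M\<^esub>"
    using absolutely_pure_solvable_system[OF M pure A ba] a(2) by blast
  define t where "t = (\<Oplus>\<^bsub>R\<^esub>i\<in>{..<n}. r i \<otimes>\<^bsub>R\<^esub> b i)"
  have "t \<in> carrier R" unfolding t_def using r b by (intro M.R.finsum_closed) auto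
  \<comment> \<open>By \<open>comb\<close>, \<open>t a\<close> is the nonzero combination
    \<open>r (b a)\<close>.\<close>
  moreover have "t \<noteq> \<zero>\<^bsub>R\<^esub>"
    using ra a(1) unfolding comb[OF r a(1)] t_def[symmetric] by (auto simp: M.smult_zero_left)
  moreover have "t \<odot>\<^bsub>M\<^esub> x = \<zero>\<^bsub>M\<^esub>" if xP: "x \<in> P" for x
  proof -
    have x: "x \<in> carrier M" using xP P_eq by blast
    obtain c where c: "\<forall>j<m. c j \<in> carrier M"
      "\<forall>i<n. (\<Oplus>\<^bsub>M\<^esub>j\<in>{..<m}. A i j \<odot>\<^bsub>M\<^esub> c j) = b i \<odot>\<^bsub>M\<^esub> x"
      using xP by (auto simp: P_eq solvable_system_def)
    have rc: "r i \<odot>\<^bsub>M\<^esub> (b i \<odot>\<^bsub>M\<^esub> x) = (\<Oplus>\<^bsub>M\<^esub>j\<in>{..<m}. (r i \<otimes>\<^bsub>R\<^esub> A i j) \<odot>\<^bsub>M\<^esub> c j)"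
      if i: "i < n" for i
    proof -
      have "r i \<odot>\<^bsub>M\<^esub> (b i \<odot>\<^bsub>M\<^esub> x) = (\<Oplus>\<^bsub>M\<^esub>j\<in>{..<m}. r i \<odot>\<^bsub>M\<^esub> (A i j \<odot>\<^bsub>M\<^esub> c j))"
        unfolding c(2)[rule_format, OF i, symmetric]
        by (rule M.smult_finsum) (use i r A c(1) in auto)
      also have "\<dots> = (\<Oplus>\<^bsub>M\<^esub>j\<in>{..<m}. (r i \<otimes>\<^bsub>R\<^esub> A i j) \<odot>\<^bsub>M\<^esub> c j)"
        by (rule M.finsum_cong') (use i r A c(1) in \<open>auto simp: M.smult_assoc1 Pi_iff\<close>)
      finally show ?thesis .
    qed
    \<comment> \<open>With \<open>A c = b x\<close>, the chain is
      \<open>t x = r (b x) = r (A c) = (r A) c = 0\<close>.\<close>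
    have "t \<odot>\<^bsub>M\<^esub> x = (\<Oplus>\<^bsub>M\<^esub>i\<in>{..<n}. r i \<odot>\<^bsub>M\<^esub> (b i \<odot>\<^bsub>M\<^esub> x))"
      unfolding t_def by (rule comb[OF r x, symmetric])
    also have "\<dots> = (\<Oplus>\<^bsub>M\<^esub>i\<in>{..<n}. \<Oplus>\<^bsub>M\<^esub>j\<in>{..<m}. (r i \<otimes>\<^bsub>R\<^esub> A i j) \<odot>\<^bsub>M\<^esub> c j)"
      by (rule M.finsum_cong') (use rc r A c(1) in \<open>auto simp: Pi_iff intro!: M.finsum_closed\<close>)
    also have "\<dots> = (\<Oplus>\<^bsub>M\<^esub>j\<in>{..<m}. \<Oplus>\<^bsub>M\<^esub>i\<in>{..<n}. (r i \<otimes>\<^bsub>R\<^esub> A i j) \<odot>\<^bsub>M\<^esub> c j)"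
      by (rule M.M.finsum_swap) (use r A c(1) in \<open>auto simp: Pi_iff\<close>)
    also have "\<dots> = (\<Oplus>\<^bsub>M\<^esub>j\<in>{..<m}. \<zero>\<^bsub>M\<^esub>)"
    proof (rule M.finsum_cong')
      fix j assume j: "j \<in> {..<m}"
      have "(\<Oplus>\<^bsub>R\<^esub>i\<in>{..<n}. r i \<otimes>\<^bsub>R\<^esub> A i j) \<odot>\<^bsub>M\<^esub> c j =
          (\<Oplus>\<^bsub>M\<^esub>i\<in>{..<n}. (r i \<otimes>\<^bsub>R\<^esub> A i j) \<odot>\<^bsub>M\<^esub> c j)"
        by (rule finsum_additive[OF M.R.abelian_group_axioms M.M.abelian_group_axioms,
              where h = "\<lambda>s. s \<odot>\<^bsub>M\<^esub> c j"])
          (use j r A c(1) in \<open>auto simp: M.smult_l_distr\<close>)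
      then show "(\<Oplus>\<^bsub>M\<^esub>i\<in>{..<n}. (r i \<otimes>\<^bsub>R\<^esub> A i j) \<odot>\<^bsub>M\<^esub> c j) = \<zero>\<^bsub>M\<^esub>"
        using rA[of j] j c(1) by (simp add: M.smult_zero_left)
    qed auto
    finally show ?thesis by simp
  qed
  ultimately show ?thesis by blast
qed

text \<open>The equation \<open>s c = a\<close> in one unknown is consistent: \<open>r s = 0\<close>
  with \<open>s \<noteq> 0\<close> forces \<open>r = 0\<close> in a domain, and then
  \<open>r a = 0\<close>.\<close>

lemma absolutely_pure_divisible:
  assumes "noncomm_domain R" and M: "left_module R M" and pure: "absolutely_pure R M"
    and s: "s \<in> carrier R" "s \<noteq> \<zero>\<^bsub>R\<^esub>" and a: "a \<in> carrier M"
  shows "\<exists>b\<in>carrier M. s \<odot>\<^bsub>M\<^esub> b = a"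
proof -
  interpret R: noncomm_domain R by fact
  interpret M: left_module R M by fact
  have "solvable_system R M 1 1 (\<lambda>_ _. s) (\<lambda>_. a)"
  proof (rule absolutely_pure_solvable_system[OF M pure])
    fix r assume r: "r \<in> {..<1::nat} \<rightarrow> carrier R"
      and z: "\<And>j::nat. j < 1 \<Longrightarrow> (\<Oplus>\<^bsub>R\<^esub>i\<in>{..<1}. r i \<otimes>\<^bsub>R\<^esub> s) = \<zero>\<^bsub>R\<^esub>"
    have r0: "r 0 \<in> carrier R" using r by auto
    have "r 0 \<otimes>\<^bsub>R\<^esub> s = \<zero>\<^bsub>R\<^esub>" using z[of 0] r0 s by (simp add: lessThan_Suc)
    then have "r 0 = \<zero>\<^bsub>R\<^esub>" using R.integral r0 s by blast
    then show "(\<Oplus>\<^bsub>M\<^esub>i\<in>{..<1}. r i \<odot>\<^bsub>M\<^esub> a) = \<zero>\<^bsub>M\<^esub>"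
      using a by (simp add: lessThan_Suc M.smult_zero_left)
  qed (use s a in auto)
  then obtain c where "c (0::nat) \<in> carrier M" "(\<Oplus>\<^bsub>M\<^esub>j\<in>{..<1::nat}. s \<odot>\<^bsub>M\<^esub> c j) = a"
    unfolding solvable_system_def by auto
  then show ?thesis using s by (auto simp: lessThan_Suc)
qed

text \<open>One equation in no unknowns: the empty sum on the left turns the condition into
  \<open>0 = t a\<close>.\<close>

lemma pp_subgroup_annihilator:
  assumes "left_module R M" "t \<in> carrier R"
  shows "pp_subgroup R M {a \<in> carrier M. t \<odot>\<^bsub>M\<^esub> a = \<zero>\<^bsub>M\<^esub>}"
proof -
  interpret M: left_module R M by fact
  have "{a \<in> carrier M. t \<odot>\<^bsub>M\<^esub> a = \<zero>\<^bsub>M\<^esub>} =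
      {a \<in> carrier M. solvable_system R M 1 0 (\<lambda>_ _. \<zero>\<^bsub>R\<^esub>) (\<lambda>_. t \<odot>\<^bsub>M\<^esub> a)}"
    by (auto simp: solvable_system_def)
  then show ?thesis
    unfolding pp_subgroup_def using assms(2)
    by (intro exI[of _ 1] exI[of _ 0] exI[of _ "\<lambda>_ _. \<zero>\<^bsub>R\<^esub>"] exI[of _ "\<lambda>_. t"]) simp
qed

lemma zero_mem_pp_subgroup:
  assumes "left_module R M" "pp_subgroup R M P"
  shows "\<zero>\<^bsub>M\<^esub> \<in> P"
proof -
  interpret M: left_module R M by fact
  obtain n m A b where A: "\<forall>i<n. \<forall>j<m. A i j \<in> carrier R" and b: "\<forall>i<n. b i \<in> carrier R"
    and P: "P = {a \<in> carrier M. solvable_system R M n m A (\<lambda>i. b i \<odot>\<^bsub>M\<^esub> a)}"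
    using assms(2) unfolding pp_subgroup_def by blast
  have "(\<Oplus>\<^bsub>M\<^esub>j\<in>{..<m}. A i j \<odot>\<^bsub>M\<^esub> \<zero>\<^bsub>M\<^esub>) = \<zero>\<^bsub>M\<^esub>" if "i < n" for i
  proof -
    have "(\<Oplus>\<^bsub>M\<^esub>j\<in>{..<m}. A i j \<odot>\<^bsub>M\<^esub> \<zero>\<^bsub>M\<^esub>) = (\<Oplus>\<^bsub>M\<^esub>j\<in>{..<m}. \<zero>\<^bsub>M\<^esub>)"
      by (rule M.finsum_cong') (use A that in \<open>auto simp: M.smult_zero_right\<close>)
    then show ?thesis by simp
  qed
  then show ?thesis
    unfolding P solvable_system_def using b
    by (auto simp: M.smult_zero_right intro!: exI[of _ "\<lambda>_. \<zero>\<^bsub>M\<^esub>"])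
qed

section \<open>Torsionfreeness, pp-simplicity and maximal pp subgroups\<close>

text \<open>A single nonzero scalar kills all of a proper pp subgroup, so torsionfreeness leaves
  only zero in it.\<close>

lemma torsionfree_imp_pp_simple:
  assumes "left_module R M" "absolutely_pure R M" "torsionfree R M"
  shows "pp_simple R M"
  unfolding pp_simple_def
proof (intro allI impI)
  fix P assume P: "pp_subgroup R M P" "P \<noteq> carrier M"
  then obtain t where "t \<in> carrier R" "t \<noteq> \<zero>\<^bsub>R\<^esub>" "\<forall>a\<in>P. t \<odot>\<^bsub>M\<^esub> a = \<zero>\<^bsub>M\<^esub>"
    using proper_pp_subgroup_annihilated[OF assms(1,2)] by blast
  moreover have "P \<subseteq> carrier M" using P(1) unfolding pp_subgroup_def by blast
  ultimately have "P \<subseteq> {\<zero>\<^bsub>M\<^esub>}" using assms(3) unfolding torsionfree_def by blast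
  then show "P = {\<zero>\<^bsub>M\<^esub>}" using zero_mem_pp_subgroup[OF assms(1) P(1)] by blast
qed

lemma maximal_proper_pp_subgroup_imp_torsionfree:
  assumes R: "noncomm_domain R" and M: "left_module R M"
    and nz: "carrier M \<noteq> {\<zero>\<^bsub>M\<^esub>}" and pure: "absolutely_pure R M"
    and "maximal_proper_pp_subgroup R M P"
  shows "torsionfree R M"
  unfolding torsionfree_def
proof (intro ballI impI)
  interpret R: noncomm_domain R by fact
  interpret M: left_module R M by fact
  define ann where "ann = (\<lambda>t. {a \<in> carrier M. t \<odot>\<^bsub>M\<^esub> a = \<zero>\<^bsub>M\<^esub>})"
  have P: "pp_subgroup R M P" "P \<noteq> carrier M"
    and max: "\<And>Q. pp_subgroup R M Q \<Longrightarrow> Q \<noteq> carrier M \<Longrightarrow> P \<subseteq> Q \<Longrightarrow> Q = P"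
    using assms(5) unfolding maximal_proper_pp_subgroup_def by blast+
  \<comment> \<open>By maximality only properness of \<open>ann u\<close> is at stake: a nonzero
    \<open>x\<close> can be written as \<open>u y\<close> by divisibility, and this \<open>y\<close>
    lies outside \<open>ann u\<close>.\<close>
  have ann_eq: "ann u = P" if u: "u \<in> carrier R" "u \<noteq> \<zero>\<^bsub>R\<^esub>" "P \<subseteq> ann u" for u
  proof (rule max[OF _ _ u(3)])
    show "pp_subgroup R M (ann u)"
      unfolding ann_def using M u(1) by (rule pp_subgroup_annihilator)
    obtain x where x: "x \<in> carrier M" "x \<noteq> \<zero>\<^bsub>M\<^esub>" using nz M.M.zero_closed by blast
    then obtain y where "y \<in> carrier M" "u \<odot>\<^bsub>M\<^esub> y = x"
      using absolutely_pure_divisible[OF R M pure u(1,2)] by blast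
    then show "ann u \<noteq> carrier M" using x unfolding ann_def by blast
  qed
  obtain t where t: "t \<in> carrier R" "t \<noteq> \<zero>\<^bsub>R\<^esub>" "\<forall>a\<in>P. t \<odot>\<^bsub>M\<^esub> a = \<zero>\<^bsub>M\<^esub>"
    using proper_pp_subgroup_annihilated[OF M pure P] by blast
  have "P \<subseteq> carrier M" using P(1) unfolding pp_subgroup_def by blast
  then have Pt: "P \<subseteq> ann t" using t(3) unfolding ann_def by blast
  fix s a assume s: "s \<in> carrier R" "s \<noteq> \<zero>\<^bsub>R\<^esub>" and a: "a \<in> carrier M" "s \<odot>\<^bsub>M\<^esub> a = \<zero>\<^bsub>M\<^esub>"
  \<comment> \<open>\<open>ann_eq\<close> can be applied to \<open>s t\<close> as well as to
    \<open>t\<close>: the product is nonzero in a domain, and \<open>s t\<close> kills whatever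
    \<open>t\<close> kills.\<close>
  have "s \<otimes>\<^bsub>R\<^esub> t \<noteq> \<zero>\<^bsub>R\<^esub>" using R.integral s t by blast
  moreover have "P \<subseteq> ann (s \<otimes>\<^bsub>R\<^esub> t)"
    using Pt s t unfolding ann_def by (auto simp: M.smult_assoc1 M.smult_zero_right)
  ultimately have "ann (s \<otimes>\<^bsub>R\<^esub> t) = ann t"
    using ann_eq[of "s \<otimes>\<^bsub>R\<^esub> t"] ann_eq[OF t(1,2) Pt] s(1) t(1) by blast
  \<comment> \<open>Divisibility moves the torsion element \<open>a\<close> back to
    \<open>b\<close>: from \<open>s t b = s a = 0\<close> it follows that \<open>b\<close> lies in
    \<open>ann (s t) = ann t\<close>, so \<open>a = t b = 0\<close>.\<close>
  moreover obtain b where b: "b \<in> carrier M" "t \<odot>\<^bsub>M\<^esub> b = a"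
    using absolutely_pure_divisible[OF R M pure t(1,2) a(1)] by blast
  moreover have "b \<in> ann (s \<otimes>\<^bsub>R\<^esub> t)"
    unfolding ann_def using b a s t by (simp add: M.smult_assoc1)
  ultimately show "a = \<zero>\<^bsub>M\<^esub>" unfolding ann_def by auto
qed

text \<open>The zero subgroup is a pp subgroup, as the annihilator of \<open>1\<close>, and it is
  proper since \<open>M\<close> is nonzero. By pp-simplicity it is the only proper one.\<close>

lemma pp_simple_imp_unique_maximal:
  assumes M: "left_module R M" and nz: "carrier M \<noteq> {\<zero>\<^bsub>M\<^esub>}" and "pp_simple R M"
  shows "\<exists>!P. maximal_proper_pp_subgroup R M P"
proof -
  interpret M: left_module R M by fact
  have "{a \<in> carrier M. \<one>\<^bsub>R\<^esub> \<odot>\<^bsub>M\<^esub> a = \<zero>\<^bsub>M\<^esub>} = {\<zero>\<^bsub>M\<^esub>}" by auto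
  then have "pp_subgroup R M {\<zero>\<^bsub>M\<^esub>}"
    using pp_subgroup_annihilator[OF M M.R.one_closed] by simp
  then have "maximal_proper_pp_subgroup R M P \<longleftrightarrow> P = {\<zero>\<^bsub>M\<^esub>}" for P
    using assms(2,3) unfolding maximal_proper_pp_subgroup_def pp_simple_def by metis
  then show ?thesis by simp
qed

text \<open>Both directions pass through torsionfreeness: a maximal proper pp subgroup forces it,
  and it implies pp-simplicity.\<close>

theorem corollary4p24:
  fixes R :: "('r, 'p) ring_scheme" and M :: "('r, 'm, 'q) module_scheme"
  assumes "noncomm_domain R"
    and "left_module R M"
    and "carrier M \<noteq> {\<zero>\<^bsub>M\<^esub>}"
    and "absolutely_pure R M"
  shows "((\<exists>P. maximal_proper_pp_subgroup R M P) \<longrightarrow> pp_simple R M \<and> torsionfree R M) \<and>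
    (torsionfree R M \<longrightarrow> pp_simple R M \<and> (\<exists>!P. maximal_proper_pp_subgroup R M P))"
  using maximal_proper_pp_subgroup_imp_torsionfree[OF assms]
    torsionfree_imp_pp_simple[OF assms(2,4)] pp_simple_imp_unique_maximal[OF assms(2,3)]
  by blast

end
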